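(* Let $d\ge 1$. Then $$\mathcal{E}\mathfrak{S}_{2d}^*=\{\mathbf{z}\in\mathbb{R}^{\pi(d)}:\ \mathbf{M}'_{2d}\text{ is positive semidefinite}\},$$ where $\mathbf{M}'_{2d}=\mathbf{M}'_{2d}(\mathbf{z})$ is the symmetric matrix whose rows and columns are indexed by the pairs $(\alpha,\lambda)$ with $\alpha\in\mathbb{N}^d$, $\lambda$ a (possibly empty) even partition of size at most $d$, and $|\alpha|+|\lambda|=d$, and whose $((\alpha,\lambda),(\alpha',\lambda'))$ entry is $z_{(\alpha+\alpha')\lambda\lambda'}$ if all entries of $\alpha+\alpha'$ are even, and $0$ otherwise. Here $(\alpha+\alpha')\lambda\lambda'$ denotes the partition of $2d$ whose parts are precisely the nonzero coordinates of $\alpha+\alpha'$ together with the parts of $\lambda$ and of $\lambda'$ (with multiplicity).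
   Context: $\mathbb{N}=\{0,1,2,\dots\}$; $|\alpha|$ is the sum of the entries of $\alpha$ and $|\lambda|$ the sum of the parts of $\lambda$. A partition is even if all its parts are even (the empty partition is even). There are $\pi(d)$ even partitions of $2d$, where $\pi(d)$ is the number of partitions of $d$; they index the coordinates of $\mathbb{R}^{\pi(d)}$. For $n,r\ge 1$ let $p_r^{(n)}=\frac{1}{n}(x_1^r+\dots+x_n^r)$ and, for a partition $\lambda$, $p_\lambda^{(n)}=\prod_{i}p_{\lambda_i}^{(n)}$. $\mathcal{E}\mathfrak{S}_{2d}$ is the set of $c\in\mathbb{R}^{\pi(d)}$ such that $\sum_\lambda c_\lambda p_\lambda^{(n)}$ (sum over even partitions $\lambda$ of $2d$) is a sum of squares of real polynomials for every $n\ge 2d$. (It is also the closure of $\bigcup_{n\ge 2d}\{c:\sum_{\lambda} c_\lambda m_\lambda^{(n)}\text{ is a sum of squares}\}$, where $m_\lambda^{(n)}$ is the arithmetic mean of all monomials obtained by permuting the variables $x_1,\dots,x_n$ in $x_1^{\lambda_1}x_2^{\lambda_2}\cdots$.) The dual cone is $\mathcal{E}\mathfrak{S}_{2d}^*=\{\mathbf{z}\in\mathbb{R}^{\pi(d)}:\sum_{\lambda}z_\lambda c_\lambda\ge 0\ \text{for all } c\in\mathcal{E}\mathfrak{S}_{2d}\}$. *)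

theory Defs
  imports Complex_Main "HOL-Library.Multiset" "HOL-Library.Poly_Mapping" "HOL-Library.FuncSet"
begin

text \<open>A monomial is its finitely supported exponent function, a polynomial a finitely supported
  family of coefficients. The variables x_1, ..., x_n are numbered 0, ..., n - 1.\<close>

type_synonym mpoly = "(nat \<Rightarrow>\<^sub>0 nat) \<Rightarrow>\<^sub>0 real"

definition poly_const :: "real \<Rightarrow> mpoly" where
  "poly_const a = Poly_Mapping.single 0 a"

definition poly_var :: "nat \<Rightarrow> mpoly" where
  "poly_var i = Poly_Mapping.single (Poly_Mapping.single i 1) 1"

definition polys_in :: "nat \<Rightarrow> mpoly set" where
  "polys_in n = {p. \<forall>m \<in> Poly_Mapping.keys p. Poly_Mapping.keys m \<subseteq> {..<n}}"

definition is_sos :: "nat \<Rightarrow> mpoly \<Rightarrow> bool" where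
  "is_sos n p \<longleftrightarrow> (\<exists>qs. set qs \<subseteq> polys_in n \<and> p = (\<Sum>q\<leftarrow>qs. q ^ 2))"

definition power_mean :: "nat \<Rightarrow> nat \<Rightarrow> mpoly" where
  "power_mean n r = poly_const (1 / real n) * (\<Sum>i<n. poly_var i ^ r)"

definition power_mean_part :: "nat \<Rightarrow> nat multiset \<Rightarrow> mpoly" where
  "power_mean_part n \<mu> = (\<Prod>r\<in>#\<mu>. power_mean n r)"

text \<open>A partition is the multiset of its (positive) parts, so that juxtaposition of partitions
  is multiset sum and the size of \<open>\<mu>\<close> is \<open>\<Sum>\<^sub># \<mu>\<close>.\<close>

definition even_partition :: "nat multiset \<Rightarrow> bool" where
  "even_partition \<mu> \<longleftrightarrow> (\<forall>r\<in>#\<mu>. 0 < r \<and> even r)"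

definition even_partitions :: "nat \<Rightarrow> nat multiset set" where
  "even_partitions k = {\<mu>. even_partition \<mu> \<and> \<Sum>\<^sub># \<mu> = k}"

text \<open>The real vectors with coordinates indexed by the even partitions of 2d. Being extensional,
  such a vector is determined by these coordinates.\<close>

definition coord_space :: "nat \<Rightarrow> (nat multiset \<Rightarrow> real) set" where
  "coord_space d = even_partitions (2 * d) \<rightarrow>\<^sub>E UNIV"

definition even_sym_sos :: "nat \<Rightarrow> (nat multiset \<Rightarrow> real) set" where
  "even_sym_sos d = {c \<in> coord_space d. \<forall>n \<ge> 2 * d.
     is_sos n (\<Sum>\<mu>\<in>even_partitions (2 * d). poly_const (c \<mu>) * power_mean_part n \<mu>)}"

definition even_sym_sos_dual :: "nat \<Rightarrow> (nat multiset \<Rightarrow> real) set" where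
  "even_sym_sos_dual d = {z \<in> coord_space d. \<forall>c \<in> even_sym_sos d.
     0 \<le> (\<Sum>\<mu>\<in>even_partitions (2 * d). z \<mu> * c \<mu>)}"

definition pos_semidef_on :: "'i set \<Rightarrow> ('i \<Rightarrow> 'i \<Rightarrow> real) \<Rightarrow> bool" where
  "pos_semidef_on I M \<longleftrightarrow>
     (\<forall>i\<in>I. \<forall>j\<in>I. M i j = M j i) \<and>
     (\<forall>v. 0 \<le> (\<Sum>i\<in>I. \<Sum>j\<in>I. v i * M i j * v j))"

text \<open>Exponent vectors \<open>\<alpha>\<close> with d entries are lists of length d.\<close>

definition row_indices :: "nat \<Rightarrow> (nat list \<times> nat multiset) set" where
  "row_indices d = {(\<alpha>, \<mu>). length \<alpha> = d \<and> even_partition \<mu> \<and> \<Sum>\<^sub># \<mu> \<le> d \<and>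
     sum_list \<alpha> + \<Sum>\<^sub># \<mu> = d}"

definition vec_add :: "nat list \<Rightarrow> nat list \<Rightarrow> nat list" where
  "vec_add \<alpha> \<beta> = map2 (+) \<alpha> \<beta>"

definition parts_of :: "nat list \<Rightarrow> nat multiset" where
  "parts_of \<gamma> = filter_mset (\<lambda>r. r \<noteq> 0) (mset \<gamma>)"

definition moment_matrix ::
  "(nat multiset \<Rightarrow> real) \<Rightarrow> nat list \<times> nat multiset \<Rightarrow> nat list \<times> nat multiset \<Rightarrow> real" where
  "moment_matrix z = (\<lambda>(\<alpha>, \<mu>) (\<alpha>', \<mu>').
     if \<forall>r \<in> set (vec_add \<alpha> \<alpha>'). even r
     then z (parts_of (vec_add \<alpha> \<alpha>') + \<mu> + \<mu>') else 0)"

lemma size_le_sum_mset: "\<forall>r\<in>#\<mu>. 0 < (r::nat) \<Longrightarrow> size \<mu> \<le> \<Sum>\<^sub># \<mu>"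
  by (induction \<mu>) auto

lemma finite_even_partitions: "finite (even_partitions k)"
proof (rule finite_subset)
  show "even_partitions k \<subseteq> mset ` {xs. set xs \<subseteq> {..k} \<and> length xs \<le> k}"
  proof
    fix \<mu> assume a: "\<mu> \<in> even_partitions k"
    obtain xs where xs: "\<mu> = mset xs" by (metis ex_mset)
    have "size \<mu> \<le> k"
      using a size_le_sum_mset[of \<mu>] by (auto simp: even_partitions_def even_partition_def)
    moreover have "\<forall>x\<in>set xs. x \<le> k"
      using a xs by (auto simp: even_partitions_def sum_mset_sum_list member_le_sum_list)
    ultimately show "\<mu> \<in> mset ` {xs. set xs \<subseteq> {..k} \<and> length xs \<le> k}"
      using xs by auto
  qed
qed (auto intro: finite_lists_length_le)

lemma finite_row_indices: "finite (row_indices d)"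
proof (rule finite_subset)
  show "row_indices d \<subseteq>
    {xs. set xs \<subseteq> {..d} \<and> length xs = d} \<times> (\<Union>k\<le>d. even_partitions k)"
    by (force simp: row_indices_def even_partitions_def dest: member_le_sum_list)
  show "finite ({xs. set xs \<subseteq> {..d} \<and> length xs = d} \<times> (\<Union>k\<le>d. even_partitions k))"
    by (intro finite_cartesian_product finite_lists_length_eq finite_UN_I finite_even_partitions) auto
qed

lemma sum_parts_of: "\<Sum>\<^sub># (parts_of \<gamma>) = sum_list \<gamma>"
  by (induction \<gamma>) (auto simp: parts_of_def)

lemma sum_list_vec_add:
  "length \<alpha> = length \<beta> \<Longrightarrow> sum_list (vec_add \<alpha> \<beta>) = sum_list \<alpha> + sum_list \<beta>"
  by (induction \<alpha> \<beta> rule: list_induct2) (auto simp: vec_add_def)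

lemma moment_matrix_index:
  assumes "(\<alpha>, \<mu>) \<in> row_indices d" "(\<alpha>', \<mu>') \<in> row_indices d"
    and "\<forall>r \<in> set (vec_add \<alpha> \<alpha>'). even r"
  shows "parts_of (vec_add \<alpha> \<alpha>') + \<mu> + \<mu>' \<in> even_partitions (2 * d)"
  using assms sum_list_vec_add[of \<alpha> \<alpha>']
  by (auto simp: row_indices_def even_partitions_def even_partition_def sum_parts_of)
     (auto simp: parts_of_def)

end

theory Submission imports Defs begin

text \<open>If \<open>z\<close> lies in the dual cone and \<open>f = \<Sum> v(\<alpha>,\<mu>) x^\<alpha> p_\<mu>\<close>, replace the variables
  \<open>x_1, \<dots>, x_d\<close> of \<open>x^\<alpha>\<close> by signed variables \<open>\<plusminus>x_i\<close>, \<open>i \<le> n\<close>, in all (not necessarily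
  injective) ways. Averaging the squares of the results gives exactly the element of the cone with
  which \<open>z\<close> pairs to the quadratic form of the moment matrix at \<open>v\<close>.

  Conversely, let the moment matrix be positive semidefinite and let \<open>L_n\<close> be the functional on
  forms of degree \<open>2d\<close> in \<open>n\<close> variables mapping \<open>x^\<gamma>\<close> to \<open>z_\<gamma>\<close> if all exponents are even and to 0
  otherwise. Then \<open>L_n (p_\<mu>)\<close> tends to \<open>z_\<mu>\<close>, so it suffices that \<open>L_n (q^2) \<ge> 0\<close> for forms
  \<open>q\<close> of degree \<open>d\<close>. As for exchangeable random variables, there are conditional expectations
  \<open>E_S\<close> integrating out the variables outside \<open>S\<close>, and the components
  \<open>q_T = \<Sum>S\<subseteq>T. (-1)^|T - S| E_S q\<close> of the Hoeffding decomposition are orthogonal.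
  Hence \<open>L_n (q^2)\<close> is the sum of the \<open>L (q_T^2)\<close>, where \<open>q_T = 0\<close> for \<open>|T| > d\<close>, and
  otherwise \<open>q_T\<close> involves only \<open>d\<close> variables besides the power means, so that \<open>L (q_T^2)\<close> is a value of the
  quadratic form of the moment matrix.\<close>


subsection \<open>Linear functionals on polynomials\<close>

abbreviation (input) lookup where "lookup \<equiv> Poly_Mapping.lookup"
abbreviation (input) keys where "keys \<equiv> Poly_Mapping.keys"
abbreviation (input) single where "single \<equiv> Poly_Mapping.single"

definition lin_ext :: "('a \<Rightarrow> real) \<Rightarrow> ('a \<Rightarrow>\<^sub>0 real) \<Rightarrow> real" where
  "lin_ext w p = (\<Sum>m\<in>keys p. lookup p m * w m)"

lemma lin_ext_add: "lin_ext w (p + q) = lin_ext w p + lin_ext w q"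
  unfolding lin_ext_def
  by (rule setsum_keys_plus_distrib) (auto simp: algebra_simps)

lemma lin_ext_0 [simp]: "lin_ext w 0 = 0"
  by (simp add: lin_ext_def)

lemma lin_ext_sum: "lin_ext w (sum f A) = (\<Sum>a\<in>A. lin_ext w (f a))"
  by (induction A rule: infinite_finite_induct) (auto simp: lin_ext_add)

lemma lin_ext_sum_list: "lin_ext w (sum_list ps) = (\<Sum>p\<leftarrow>ps. lin_ext w p)"
  by (induction ps) (auto simp: lin_ext_add)

lemma lin_ext_single [simp]: "lin_ext w (single m a) = a * w m"
  by (simp add: lin_ext_def)

lemma sum_singles: "(\<Sum>m\<in>keys p. single m (lookup p m)) = p"
  by (rule poly_mapping_eqI)
     (auto simp: lookup_sum lookup_single when_def in_keys_iff)

lemma lin_ext_mult: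
  fixes w :: "'a :: monoid_add \<Rightarrow> real"
  shows "lin_ext w (p * q) = (\<Sum>a\<in>keys p. \<Sum>b\<in>keys q. lookup p a * lookup q b * w (a + b))"
proof -
  have "p * q = (\<Sum>a\<in>keys p. single a (lookup p a)) * (\<Sum>b\<in>keys q. single b (lookup q b))"
    by (simp add: sum_singles)
  also have "\<dots> = (\<Sum>a\<in>keys p. \<Sum>b\<in>keys q. single (a + b) (lookup p a * lookup q b))"
    by (simp add: sum_product mult_single)
  finally show ?thesis by (simp add: lin_ext_sum)
qed

lemma lin_ext_single_mult:
  fixes w :: "'a :: monoid_add \<Rightarrow> real"
  shows "lin_ext w (single m a * q) = a * lin_ext (\<lambda>b. w (m + b)) q"
  by (cases "a = 0") (simp_all add: lin_ext_mult, simp add: lin_ext_def sum_distrib_left mult.assoc)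

text \<open>Makes coefficient extraction a special case of \<open>lin_ext\<close>, so that facts
  proved for all weights \<open>w\<close> apply to coefficients.\<close>

lemma lookup_eq_lin_ext: "lookup p k = lin_ext (\<lambda>m. if m = k then 1 else 0) p"
  by (simp add: lin_ext_def in_keys_iff if_distrib[of "\<lambda>x. _ * x"] cong: if_cong)

lemma lookup_mult_finite:
  fixes p q :: "'a :: monoid_add \<Rightarrow>\<^sub>0 real"
  shows "lookup (p * q) k =
    (\<Sum>a\<in>keys p. \<Sum>b\<in>keys q. if a + b = k then lookup p a * lookup q b else 0)"
  by (simp add: lookup_eq_lin_ext[of "p * q"] lin_ext_mult if_distrib cong: if_cong)

text \<open>Among the monomials of minimal degree pick the least one for the monomial order:
  its square has a positive coefficient in the sum of squares, so no cancellation can occur.\<close>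

lemma sum_squares_min_degree:
  fixes qs :: "mpoly list" and deg :: "(nat \<Rightarrow>\<^sub>0 nat) \<Rightarrow> nat"
  assumes deg: "\<And>a b. deg (a + b) = deg a + deg b"
    and low: "\<And>k. lookup (\<Sum>q\<leftarrow>qs. q ^ 2) k \<noteq> 0 \<Longrightarrow> 2 * d \<le> deg k"
    and "q \<in> set qs" "m \<in> keys q"
  shows "d \<le> deg m"
proof (rule ccontr)
  assume "\<not> d \<le> deg m"
  define X where "X = (\<Union>q\<in>set qs. keys q)"
  have X: "finite X" "m \<in> X" using assms by (auto simp: X_def)
  define k where "k = Min (deg ` X)"
  have k: "k \<le> deg a" if "a \<in> X" for a using X that by (simp add: k_def)
  have "k \<in> deg ` X" unfolding k_def using X by (intro Min_in) auto
  have "k < d" using k[OF X(2)] \<open>\<not> d \<le> deg m\<close> by simp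
  define Y where "Y = {a \<in> X. deg a = k}"
  have Y: "finite Y" "Y \<noteq> {}" using X \<open>k \<in> deg ` X\<close> by (auto simp: Y_def)
  define a0 where "a0 = Min Y"
  have a0: "a0 \<in> Y" using Y by (simp add: a0_def)
  have min: "a0 \<le> a" if "a \<in> Y" for a using Y that by (simp add: a0_def)
  \<comment> \<open>Since \<open>k\<close> is the minimal degree, both summands have degree
    \<open>k\<close>. Both then lie above \<open>a0\<close> in the monomial order, which is
    compatible with addition, so neither can be strictly larger.\<close>
  have uniq: "a = a0 \<and> b = a0" if "a \<in> X" "b \<in> X" "a + b = a0 + a0" for a b
  proof -
    have "deg a + deg b = k + k" using that deg a0 by (metis (mono_tags, lifting) Y_def mem_Collect_eq)
    then have "a \<in> Y" "b \<in> Y" using k[OF that(1)] k[OF that(2)] that by (auto simp: Y_def)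
    then have "a0 \<le> a" "a0 \<le> b" by (auto intro: min)
    have "\<not> a0 < a"
    proof
      assume "a0 < a"
      then have "a0 + a0 < a + b" using \<open>a0 \<le> b\<close> by (rule add_less_le_mono)
      with that(3) show False by simp
    qed
    then have "a = a0" using \<open>a0 \<le> a\<close> by (metis order.not_eq_order_implies_strict)
    then show ?thesis using that(3) by simp
  qed
  have sq: "lookup (q ^ 2) (a0 + a0) = (lookup q a0)\<^sup>2" if "q \<in> set qs" for q
  proof -
    have "lookup (q ^ 2) (a0 + a0) = (\<Sum>a\<in>keys q. \<Sum>b\<in>keys q.
        if a = a0 \<and> b = a0 then lookup q a * lookup q b else 0)"
      unfolding power2_eq_square lookup_mult_finite
    proof (intro sum.cong refl)
      fix a b assume "a \<in> keys q" "b \<in> keys q"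
      then have "a + b = a0 + a0 \<longleftrightarrow> a = a0 \<and> b = a0"
        using uniq[of a b] that by (auto simp: X_def)
      then show "(if a + b = a0 + a0 then lookup q a * lookup q b else 0) =
          (if a = a0 \<and> b = a0 then lookup q a * lookup q b else 0)" by simp
    qed
    also have "\<dots> = (\<Sum>a\<in>keys q. if a = a0 then (\<Sum>b\<in>keys q. if b = a0 then lookup q a * lookup q b else 0) else 0)"
      by (intro sum.cong) auto
    also have "\<dots> = (lookup q a0)\<^sup>2"
      by (auto simp: power2_eq_square in_keys_iff)
    finally show ?thesis .
  qed
  have lookup_sum_list: "lookup (sum_list ps) c = (\<Sum>p\<leftarrow>ps. lookup p c)" for ps :: "mpoly list" and c
    by (induction ps) (auto simp: lookup_add)
  have "lookup (\<Sum>q\<leftarrow>qs. q ^ 2) (a0 + a0) = (\<Sum>q\<leftarrow>qs. (lookup q a0)\<^sup>2)"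
    unfolding lookup_sum_list map_map comp_def using sq by (metis (mono_tags, lifting) map_eq_conv)
  \<comment> \<open>The degree of \<open>a0 + a0\<close> is \<open>2 * k < 2 * d\<close>, so
    \<open>low\<close> forces this coefficient to vanish.\<close>
  moreover have "lookup (\<Sum>q\<leftarrow>qs. q ^ 2) (a0 + a0) = 0"
    using low[of "a0 + a0"] a0 \<open>k < d\<close> by (fastforce simp: deg Y_def)
  ultimately have "\<forall>x \<in> set (map (\<lambda>q. (lookup q a0)\<^sup>2) qs). x = 0"
    by (subst sum_list_nonneg_eq_0_iff[symmetric]) auto
  then show False using a0 by (auto simp: Y_def X_def in_keys_iff)
qed

section \<open>Products of power means under linear functionals\<close>

lemma poly_var_power: "poly_var i ^ r = single (single i r) 1"
proof (induction r)
  case (Suc r)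
  have "poly_var i ^ Suc r = single (single i 1) 1 * single (single i r) 1"
    using Suc by (simp add: poly_var_def)
  then show ?case by (simp add: mult_single flip: single_add)
qed simp

text \<open>Multiplying by a power mean averages the functional over shifts of its weight by
  \<open>single i r\<close>; hence the inductions on \<mu> below generalise over the weight or its
  shift.\<close>

lemma lin_ext_power_mean_part_add:
  "lin_ext w (power_mean_part n (add_mset r \<mu>)) =
    (\<Sum>i<n. lin_ext (\<lambda>b. w (single i r + b)) (power_mean_part n \<mu>)) / real n"
proof -
  have "power_mean n r = (\<Sum>i<n. single (single i r) (1 / real n))"
    by (simp add: power_mean_def poly_const_def poly_var_power sum_distrib_left mult_single)
  then have "power_mean_part n (add_mset r \<mu>) =
      (\<Sum>i<n. single (single i r) (1 / real n) * power_mean_part n \<mu>)"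
    by (simp add: power_mean_part_def sum_distrib_right)
  then show ?thesis
    by (simp add: lin_ext_sum lin_ext_single_mult sum_divide_distrib)
qed

lemma lin_ext_power_mean_part_empty: "lin_ext w (power_mean_part n {#}) = w 0"
  by (simp add: power_mean_part_def flip: single_one)

text \<open>For \<open>n > 0\<close> a product of power means is a convex combination of
  monomials.\<close>

lemma lin_ext_power_mean_part_bound:
  assumes "\<And>m. \<bar>w m\<bar> \<le> C"
  shows "\<bar>lin_ext w (power_mean_part n \<mu>)\<bar> \<le> C"
  using assms
proof (induction \<mu> arbitrary: w)
  case empty
  then show ?case by (simp add: lin_ext_power_mean_part_empty)
next
  case (add r \<mu>)
  show ?case
  proof (cases "n = 0")
    \<comment> \<open>Division by zero makes the value 0 here, and the bound at the monomial 0 gives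
      \<open>0 \<le> C\<close>.\<close>
    case True
    with add.prems[of 0] show ?thesis by (simp add: lin_ext_power_mean_part_add)
  next
    case False
    have "\<bar>\<Sum>i<n. lin_ext (\<lambda>b. w (single i r + b)) (power_mean_part n \<mu>)\<bar> \<le> (\<Sum>i<n. C)"
      by (intro order.trans[OF sum_abs] sum_mono add.IH add.prems)
    with False show ?thesis
      by (simp add: lin_ext_power_mean_part_add field_simps)
  qed
qed

definition var_degree :: "nat \<Rightarrow> (nat \<Rightarrow>\<^sub>0 nat) \<Rightarrow> nat" where
  "var_degree n m = (\<Sum>i<n. lookup m i)"

lemma var_degree_add: "var_degree n (a + b) = var_degree n a + var_degree n b"
  by (simp add: var_degree_def lookup_add sum.distrib)

lemma var_degree_single: "i < n \<Longrightarrow> var_degree n (single i r) = r"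
  by (simp add: var_degree_def lookup_single when_def)

text \<open>With \<open>w\<close> the indicator of a monomial of another degree this yields a zero
  coefficient: the product is homogeneous of degree the size of \<mu>.\<close>

lemma lin_ext_power_mean_part_homogeneous:
  assumes "\<And>m. var_degree n m = \<Sum>\<^sub># \<mu> \<Longrightarrow> w m = 0"
  shows "lin_ext w (power_mean_part n \<mu>) = 0"
  using assms
proof (induction \<mu> arbitrary: w)
  case empty
  then show ?case by (simp add: lin_ext_power_mean_part_empty var_degree_def)
next
  case (add r \<mu>)
  have "lin_ext (\<lambda>b. w (single i r + b)) (power_mean_part n \<mu>) = 0" if "i < n" for i
    using that by (intro add.IH add.prems) (simp add: var_degree_add var_degree_single)
  then show ?case by (simp add: lin_ext_power_mean_part_add)
qed


subsection \<open>Alternating sums over subsets\<close>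

lemma sum_Pow_insert:
  fixes h :: "'a set \<Rightarrow> 'b :: comm_monoid_add"
  assumes "finite T" "i \<notin> T"
  shows "(\<Sum>S\<in>Pow (insert i T). h S) = (\<Sum>S\<in>Pow T. h S + h (insert i S))"
proof -
  have "Pow T \<inter> insert i ` Pow T = {}" "inj_on (insert i) (Pow T)"
    using assms by (auto simp: inj_on_def)
  then show ?thesis
    using assms by (simp add: Pow_insert sum.union_disjoint sum.reindex sum.distrib)
qed

text \<open>Moebius inversion on the subset lattice. The exponent has the parity of
  \<open>card (T - U)\<close> and avoids subtraction.\<close>

definition alt_sum :: "'a set \<Rightarrow> ('a set \<Rightarrow> real) \<Rightarrow> real" where
  "alt_sum T g = (\<Sum>U\<in>Pow T. (-1) ^ (card T + card U) * g U)"

text \<open>Alternating sums are iterated differences, one for each element of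
  \<open>T\<close>.\<close>

lemma alt_sum_insert:
  assumes "finite T" "i \<notin> T"
  shows "alt_sum (insert i T) g = alt_sum T (\<lambda>U. g (insert i U) - g U)"
proof -
  have "card (insert i U) = Suc (card U)" if "U \<in> Pow T" for U
    using that assms by (subst card_insert_disjoint) (auto dest: finite_subset)
  then show ?thesis
    using assms by (auto simp: alt_sum_def sum_Pow_insert algebra_simps intro!: sum.cong)
qed

lemma alt_sum_diff: "alt_sum T (\<lambda>U. f U - g U) = alt_sum T f - alt_sum T g"
  by (simp add: alt_sum_def sum_subtractf algebra_simps)

text \<open>With \<open>g (S \<inter> S')\<close> the expectation of \<open>E_S q * E_S' q'\<close>, the right-hand side is the
  expectation of \<open>q_T * q'_T\<close>.\<close>

lemma alt_sum_inter:
  assumes "finite T"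
  shows "alt_sum T g = (\<Sum>S\<in>Pow T. \<Sum>S'\<in>Pow T. (-1) ^ (card S + card S') * g (S \<inter> S'))"
  using assms
proof (induction T arbitrary: g rule: finite_induct)
  case empty
  then show ?case by (simp add: alt_sum_def)
next
  case (insert i T)
  have "card (insert i U) = Suc (card U)" if "U \<in> Pow T" for U
    using that insert.hyps by (subst card_insert_disjoint) (auto dest: finite_subset)
  moreover have "insert i S \<inter> S' = S \<inter> S'" "S \<inter> insert i S' = S \<inter> S'"
    "insert i S \<inter> insert i S' = insert i (S \<inter> S')" if "S \<in> Pow T" "S' \<in> Pow T" for S S'
    using that insert.hyps by auto
  ultimately have "(\<Sum>S\<in>Pow (insert i T). \<Sum>S'\<in>Pow (insert i T). (-1) ^ (card S + card S') * g (S \<inter> S')) =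
    (\<Sum>S\<in>Pow T. \<Sum>S'\<in>Pow T. (-1) ^ (card S + card S') * (g (insert i (S \<inter> S')) - g (S \<inter> S')))"
    unfolding sum_Pow_insert[OF insert.hyps] sum.distrib[symmetric]
    by (intro sum.cong refl) (simp add: algebra_simps)
  then show ?case
    by (simp only: alt_sum_insert[OF insert.hyps] insert.IH)
qed

text \<open>Inverts the alternating sum. With \<open>g U\<close> the expectation of the square of
  \<open>E_U q\<close>, it splits the expectation for \<open>U = N\<close> into the contributions of
  the Hoeffding components.\<close>

lemma sum_alt_sum:
  assumes "finite N"
  shows "(\<Sum>T\<in>Pow N. alt_sum T g) = g N"
  using assms
proof (induction N arbitrary: g rule: finite_induct)
  case empty
  then show ?case by (simp add: alt_sum_def)
next
  case (insert i N)
  have "alt_sum (insert i T) g = alt_sum T (\<lambda>U. g (insert i U)) - alt_sum T g" if "T \<in> Pow N" for T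
    using that insert.hyps by (subst alt_sum_insert) (auto simp: alt_sum_diff dest: finite_subset)
  then show ?case
    using insert.IH[of "\<lambda>U. g (insert i U)"] by (simp add: sum_Pow_insert[OF insert.hyps])
qed

text \<open>The difference in direction \<open>i\<close> already vanishes. This eliminates the
  components with \<open>card T > d\<close>.\<close>

lemma alt_sum_eq_0:
  assumes "finite T" "i \<in> T" "\<And>U. U \<subseteq> T \<Longrightarrow> g (insert i U) = g U"
  shows "alt_sum T g = 0"
proof -
  obtain T0 where "T = insert i T0" "i \<notin> T0" using assms(2) by (meson Set.set_insert)
  then show ?thesis
    using assms by (subst \<open>T = _\<close>, subst alt_sum_insert)
      (auto simp: alt_sum_def subset_insertI2 intro!: sum.neutral)
qed

subsection \<open>Positivity of the moment functional\<close>

definition parts_on :: "'a set \<Rightarrow> ('a \<Rightarrow> nat) \<Rightarrow> nat multiset" where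
  "parts_on V g = filter_mset (\<lambda>r. r \<noteq> 0) (image_mset g (mset_set V))"

lemma parts_on_empty [simp]: "parts_on {} g = {#}"
  by (simp add: parts_on_def)

lemma parts_on_Un:
  assumes "finite V" "finite W" "V \<inter> W = {}"
  shows "parts_on (V \<union> W) g = parts_on V g + parts_on W g"
  using assms by (simp add: parts_on_def mset_set_Union)

lemma parts_on_insert:
  assumes "finite V" "i \<notin> V"
  shows "parts_on (insert i V) g = (if g i = 0 then {#} else {#g i#}) + parts_on V g"
  using assms by (simp add: parts_on_def)

lemma parts_on_cong: "(\<And>i. i \<in> V \<Longrightarrow> f i = g i) \<Longrightarrow> parts_on V f = parts_on V g"
  unfolding parts_on_def by (cases "finite V") (auto intro!: arg_cong[where f = "filter_mset _"] image_mset_cong)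

lemma parts_on_zero: "(\<And>i. i \<in> V \<Longrightarrow> g i = 0) \<Longrightarrow> parts_on V g = {#}"
  unfolding parts_on_def by (cases "finite V") auto

lemma sum_parts_on: "\<Sum>\<^sub># (parts_on V g) = (\<Sum>i\<in>V. g i)"
proof (induction V rule: infinite_finite_induct)
  case (insert i V)
  then show ?case by (simp add: parts_on_insert)
qed (simp_all add: parts_on_def)

lemma even_partition_parts_on: "(\<And>i. i \<in> V \<Longrightarrow> even (g i)) \<Longrightarrow> even_partition (parts_on V g)"
  by (cases "finite V") (auto simp: even_partition_def parts_on_def)

lemma even_partition_add: "even_partition (\<mu> + \<nu>) \<longleftrightarrow> even_partition \<mu> \<and> even_partition \<nu>"
  by (auto simp: even_partition_def)

lemma parts_of_map: "distinct xs \<Longrightarrow> parts_of (map g xs) = parts_on (set xs) g"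
  by (simp add: parts_of_def parts_on_def mset_set_set)

lemma moment_matrix_sym:
  assumes "r \<in> row_indices d" "s \<in> row_indices d"
  shows "moment_matrix z r s = moment_matrix z s r"
proof -
  have "vec_add \<alpha> \<beta> = vec_add \<beta> \<alpha>" for \<alpha> \<beta>
    unfolding vec_add_def by (subst zip_commute) (simp add: comp_def case_prod_beta add.commute)
  then show ?thesis
    by (auto simp: moment_matrix_def case_prod_beta ac_simps)
qed

text \<open>Several \<open>j\<close> may share a row; their coefficients are added up into one
  vector \<open>v\<close> on \<open>I\<close>.\<close>

lemma pos_semidef_on_pullback:
  assumes "pos_semidef_on I M" "finite I" "finite J" "row ` J \<subseteq> I"
  shows "0 \<le> (\<Sum>j\<in>J. \<Sum>k\<in>J. c j * M (row j) (row k) * c k)"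
proof -
  define v where "v r = (\<Sum>j\<in>{j \<in> J. row j = r}. c j)" for r
  have grp: "(\<Sum>j\<in>J. h j) = (\<Sum>r\<in>I. \<Sum>j\<in>{j \<in> J. row j = r}. h j)" for h :: "_ \<Rightarrow> real"
    using assms by (simp add: sum.group)
  have "(\<Sum>j\<in>J. \<Sum>k\<in>J. c j * M (row j) (row k) * c k) =
      (\<Sum>r\<in>I. \<Sum>j\<in>{j \<in> J. row j = r}. \<Sum>s\<in>I. \<Sum>k\<in>{k \<in> J. row k = s}. c j * M r s * c k)"
    by (subst grp, subst grp, intro sum.cong refl) auto
  also have "\<dots> = (\<Sum>r\<in>I. \<Sum>s\<in>I. v r * M r s * v s)"
    unfolding v_def sum_distrib_left sum_distrib_right
    by (subst sum.swap, intro sum.cong refl)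
       (subst sum.swap, intro sum.cong refl sum.swap)
  finally show ?thesis using assms(1) by (simp add: pos_semidef_on_def)
qed

text \<open>Rows of the moment matrix may be indexed by exponent functions on any set of at most
  \<open>d\<close> variables.\<close>

lemma moment_form_nonneg:
  fixes a :: "'j \<Rightarrow> nat \<Rightarrow> nat" and m :: "'j \<Rightarrow> nat multiset"
  assumes psd: "pos_semidef_on (row_indices d) (moment_matrix z)"
    and J: "finite J" and T: "finite T" "card T \<le> d"
    and supp: "\<And>j i. j \<in> J \<Longrightarrow> i \<notin> T \<Longrightarrow> a j i = 0"
    and m: "\<And>j. j \<in> J \<Longrightarrow> even_partition (m j)"
    and deg: "\<And>j. j \<in> J \<Longrightarrow> (\<Sum>i\<in>T. a j i) + \<Sum>\<^sub># (m j) = d"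
  shows "0 \<le> (\<Sum>j\<in>J. \<Sum>k\<in>J. c j * (if \<forall>i\<in>T. even (a j i + a k i)
    then z (parts_on T (\<lambda>i. a j i + a k i) + m j + m k) else 0) * c k)"
proof -
  \<comment> \<open>Rows need exactly \<open>d\<close> exponents, so \<open>T\<close> is padded with
    fresh variables. Their exponents are 0, which changes neither parities nor parts.\<close>
  obtain T' where T': "T \<subseteq> T'" "finite T'" "card T' = d"
  proof -
    obtain X where "X \<subseteq> - T" "finite X" "card X = d - card T"
      using infinite_arbitrarily_large[of "- T" "d - card T"] T(1) by (auto simp: Compl_eq_Diff_UNIV)
    then show ?thesis
      using T that[of "T \<union> X"] card_Un_disjoint[of T X] by auto
  qed
  obtain xs where xs: "distinct xs" "set xs = T'" by (metis T'(2) finite_distinct_list)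
  have len: "length xs = d" using xs T' distinct_card by fastforce
  define row where "row j = (map (a j) xs, m j)" for j
  have "sum_list (map (a j) xs) = (\<Sum>i\<in>T. a j i)" if "j \<in> J" for j
    using T' supp that by (simp add: sum_list_distinct_conv_sum_set xs)
      (intro sum.mono_neutral_right; auto)
  then have rows: "row ` J \<subseteq> row_indices d"
    using m deg len by (force simp: row_indices_def row_def)
  have "(\<Sum>j\<in>J. \<Sum>k\<in>J. c j * (if \<forall>i\<in>T. even (a j i + a k i)
    then z (parts_on T (\<lambda>i. a j i + a k i) + m j + m k) else 0) * c k) =
    (\<Sum>j\<in>J. \<Sum>k\<in>J. c j * moment_matrix z (row j) (row k) * c k)"
  proof (intro sum.cong refl)
    fix j k assume "j \<in> J" "k \<in> J"
    then have zero: "a j i = 0" "a k i = 0" if "i \<in> T' - T" for i using supp that by auto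
    have va: "vec_add (map (a j) xs) (map (a k) xs) = map (\<lambda>i. a j i + a k i) xs"
      by (simp add: vec_add_def map2_map_map)
    have "parts_on (T' - T) (\<lambda>i. a j i + a k i) = {#}"
      by (rule parts_on_zero) (simp add: zero)
    then have "parts_on T' (\<lambda>i. a j i + a k i) = parts_on T (\<lambda>i. a j i + a k i)"
      using parts_on_Un[of T "T' - T" "\<lambda>i. a j i + a k i"] T'
      by (simp add: Un_absorb1 finite_subset)
    moreover have "(\<forall>r\<in>set (map (\<lambda>i. a j i + a k i) xs). even r) \<longleftrightarrow> (\<forall>i\<in>T. even (a j i + a k i))"
      using zero T'(1) xs(2) by auto
    ultimately show "c j * (if \<forall>i\<in>T. even (a j i + a k i)
      then z (parts_on T (\<lambda>i. a j i + a k i) + m j + m k) else 0) * c k =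
      c j * moment_matrix z (row j) (row k) * c k"
      unfolding moment_matrix_def row_def va prod.case
      using parts_of_map[OF xs(1)] xs(2) by simp
  qed
  then show ?thesis
    using pos_semidef_on_pullback[OF psd finite_row_indices J rows, of c] by simp
qed

section \<open>The Hoeffding decomposition\<close>

text \<open>The kernel of the form \<open>E (E_U f * E_U g)\<close>, where \<open>E_U\<close> integrates out the
  variables of \<open>N\<close> outside \<open>U\<close>, replacing an even power of such a variable by the power mean of
  that exponent and an odd power by 0.\<close>

definition cond_kernel ::
  "(nat multiset \<Rightarrow> real) \<Rightarrow> nat set \<Rightarrow> nat set \<Rightarrow> (nat \<Rightarrow> nat) \<Rightarrow> (nat \<Rightarrow> nat) \<Rightarrow> real" where
  "cond_kernel z N U f g =
    (if (\<forall>i\<in>U. even (f i + g i)) \<and> (\<forall>i\<in>N - U. even (f i) \<and> even (g i))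
     then z (parts_on U (\<lambda>i. f i + g i) + parts_on (N - U) f + parts_on (N - U) g) else 0)"

text \<open>Integrating out a variable absent from \<open>f\<close> changes nothing: either way
  \<open>g i\<close> must be even and contributes itself as a part, if nonzero.\<close>

lemma cond_kernel_insert:
  assumes "finite N" "insert i U \<subseteq> N" "f i = 0"
  shows "cond_kernel z N (insert i U) f g = cond_kernel z N U f g"
proof (cases "i \<in> U")
  case False
  define W where "W = N - insert i U"
  have W: "N - U = insert i W" "i \<notin> W" "finite W" "finite U"
    using assms False by (auto simp: W_def dest: finite_subset)
  show ?thesis
    unfolding cond_kernel_def W_def[symmetric] W(1)
    using assms(3) W False by (auto simp: parts_on_insert)
qed (simp add: insert_absorb)

text \<open>The expectation of \<open>E_S f * E_S' g\<close> depends only on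
  \<open>S \<inter> S'\<close>. The right-hand side has the shape of a moment matrix entry:
  \<open>E_S f\<close> keeps the exponents on \<open>S\<close> and turns the others into power
  means.\<close>

lemma cond_kernel_inter:
  assumes N: "finite N" "T \<subseteq> N" and S: "S \<subseteq> T" "S' \<subseteq> T"
  defines "a \<equiv> \<lambda>S (f :: nat \<Rightarrow> nat) i. if i \<in> S then f i else 0 :: nat"
  shows "cond_kernel z N (S \<inter> S') f g =
    (if (\<forall>i\<in>N - S. even (f i)) \<and> (\<forall>i\<in>N - S'. even (g i)) then
      (if \<forall>i\<in>T. even (a S f i + a S' g i)
       then z (parts_on T (\<lambda>i. a S f i + a S' g i) + parts_on (N - S) f + parts_on (N - S') g)
       else 0) else 0)"
proof -
  have fin: "finite T" "finite S" "finite S'" using N S by (auto dest: finite_subset)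
  have 1: "(\<forall>i\<in>S \<inter> S'. even (f i + g i)) \<and> (\<forall>i\<in>N - S \<inter> S'. even (f i) \<and> even (g i)) \<longleftrightarrow>
     ((\<forall>i\<in>N - S. even (f i)) \<and> (\<forall>i\<in>N - S'. even (g i))) \<and> (\<forall>i\<in>T. even (a S f i + a S' g i))"
    (is "?L \<longleftrightarrow> ?R")
  proof -
    have "?L \<longleftrightarrow> (\<forall>i\<in>N. if i \<in> S \<and> i \<in> S' then even (f i + g i) else even (f i) \<and> even (g i))"
      using S N by auto
    also have "\<dots> \<longleftrightarrow> (\<forall>i\<in>N. (i \<notin> S \<longrightarrow> even (f i)) \<and> (i \<notin> S' \<longrightarrow> even (g i)) \<and>
        (i \<in> T \<longrightarrow> even (a S f i + a S' g i)))"
      using S by (intro ball_cong refl) (auto simp: a_def)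
    also have "\<dots> \<longleftrightarrow> ?R" using N by blast
    finally show ?thesis .
  qed
  have T: "T = (S \<inter> S') \<union> (S - S') \<union> (S' - S) \<union> (T - (S \<union> S'))" using S by auto
  have "parts_on T (\<lambda>i. a S f i + a S' g i) =
      parts_on (S \<inter> S') (\<lambda>i. a S f i + a S' g i) + parts_on (S - S') (\<lambda>i. a S f i + a S' g i) +
      parts_on (S' - S) (\<lambda>i. a S f i + a S' g i) + parts_on (T - (S \<union> S')) (\<lambda>i. a S f i + a S' g i)"
    by (subst (1) T, (subst parts_on_Un; use fin in auto)+)
  also have "\<dots> = parts_on (S \<inter> S') (\<lambda>i. f i + g i) + parts_on (S - S') f + parts_on (S' - S) g"
  proof -
    have "parts_on (S \<inter> S') (\<lambda>i. a S f i + a S' g i) = parts_on (S \<inter> S') (\<lambda>i. f i + g i)"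
      "parts_on (S - S') (\<lambda>i. a S f i + a S' g i) = parts_on (S - S') f"
      "parts_on (S' - S) (\<lambda>i. a S f i + a S' g i) = parts_on (S' - S) g"
      by (intro parts_on_cong; simp add: a_def)+
    moreover have "parts_on (T - (S \<union> S')) (\<lambda>i. a S f i + a S' g i) = {#}"
      by (intro parts_on_zero) (simp add: a_def)
    ultimately show ?thesis by simp
  qed
  finally have 2: "parts_on T (\<lambda>i. a S f i + a S' g i) =
    parts_on (S \<inter> S') (\<lambda>i. f i + g i) + parts_on (S - S') f + parts_on (S' - S) g" .
  \<comment> \<open>A variable of \<open>S - S'\<close> counts as kept in \<open>E_S f\<close> but
    as integrated out over \<open>S \<inter> S'\<close>; its part moves from the first block to the
    second.\<close>
  have "N - S \<inter> S' = (N - S) \<union> (S - S')" using S N by auto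
  then have 3: "parts_on (N - S \<inter> S') f = parts_on (N - S) f + parts_on (S - S') f"
    by (simp only:, subst parts_on_Un) (use fin N in auto)
  have "N - S \<inter> S' = (N - S') \<union> (S' - S)" using S N by auto
  then have 4: "parts_on (N - S \<inter> S') g = parts_on (N - S') g + parts_on (S' - S) g"
    by (simp only:, subst parts_on_Un) (use fin N in auto)
  show ?thesis
    unfolding cond_kernel_def 1 2 3 4 by (simp add: ac_simps)
qed


text \<open>This is the expectation of the square of \<open>q_T\<close>. If
  \<open>card T > d\<close>, every monomial of degree \<open>d\<close> misses a variable of
  \<open>T\<close> and the component vanishes. Otherwise expanding \<open>q_T\<close> gives a value
  of the moment form on the variables in \<open>T\<close>.\<close>

lemma alt_sum_cond_kernel_nonneg:
  fixes e :: "'b \<Rightarrow> nat \<Rightarrow> nat"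
  assumes psd: "pos_semidef_on (row_indices d) (moment_matrix z)"
    and N: "finite N" "T \<subseteq> N" and B: "finite B"
    and deg: "\<And>b. b \<in> B \<Longrightarrow> (\<Sum>i\<in>N. e b i) = d"
  shows "0 \<le> (\<Sum>b\<in>B. \<Sum>b'\<in>B. q b * alt_sum T (\<lambda>U. cond_kernel z N U (e b) (e b')) * q b')"
proof (cases "card T \<le> d")
  case False
  have "finite T" using N by (auto dest: finite_subset)
  have "alt_sum T (\<lambda>U. cond_kernel z N U (e b) (e b')) = 0" if "b \<in> B" for b b'
  proof -
    have "\<exists>i\<in>T. e b i = 0"
    proof (rule ccontr)
      assume "\<not> (\<exists>i\<in>T. e b i = 0)"
      then have "(\<Sum>i\<in>T. 1) \<le> (\<Sum>i\<in>T. e b i)" by (intro sum_mono) (auto simp: Suc_le_eq)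
      also have "\<dots> \<le> (\<Sum>i\<in>N. e b i)" using N by (intro sum_mono2) auto
      finally show False using deg[OF that] False by simp
    qed
    then obtain i where "i \<in> T" "e b i = 0" by blast
    then show ?thesis
      using N \<open>finite T\<close> by (intro alt_sum_eq_0[of T i] cond_kernel_insert) auto
  qed
  then show ?thesis by simp
next
  case True
  have finT: "finite T" using N by (auto dest: finite_subset)
  define a where "a S f = (\<lambda>i. if i \<in> S then f i else 0)" for S :: "nat set" and f :: "nat \<Rightarrow> nat"
  define ok where "ok S b \<longleftrightarrow> (\<forall>i\<in>N - S. even (e b i))" for S b
  \<comment> \<open>A pair \<open>(S, b)\<close> stands for \<open>E_S\<close> of the monomial with
    exponents \<open>e b\<close>, which is 0 unless all exponents outside \<open>S\<close> are
    even.\<close>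
  define J where "J = {(S, b) \<in> Pow T \<times> B. ok S b}"
  have J: "finite J" unfolding J_def using finT B by (auto intro: finite_subset[of _ "Pow T \<times> B"])
  define G where "G S b S' b' = (if \<forall>i\<in>T. even (a S (e b) i + a S' (e b') i)
    then z (parts_on T (\<lambda>i. a S (e b) i + a S' (e b') i) + parts_on (N - S) (e b) + parts_on (N - S') (e b'))
    else 0)" for S b S' b'
  have kernel: "cond_kernel z N (S \<inter> S') (e b) (e b') = (if ok S b \<and> ok S' b' then G S b S' b' else 0)"
    if "S \<in> Pow T" "S' \<in> Pow T" for S S' b b'
    using cond_kernel_inter[OF N, of S S' z "e b" "e b'"] that
    by (simp add: G_def ok_def a_def)
  \<comment> \<open>The common sign \<open>(-1) ^ card T\<close> of all terms of \<open>q_T\<close>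
    is dropped, as it cancels in the square.\<close>
  define c where "c j = (-1) ^ card (fst j) * q (snd j)" for j :: "nat set \<times> 'b"
  have "(\<Sum>b\<in>B. \<Sum>b'\<in>B. q b * alt_sum T (\<lambda>U. cond_kernel z N U (e b) (e b')) * q b') =
    (\<Sum>b\<in>B. \<Sum>b'\<in>B. \<Sum>S\<in>Pow T. \<Sum>S'\<in>Pow T. if ok S b \<and> ok S' b' then c (S, b) * G S b S' b' * c (S', b') else 0)"
    unfolding alt_sum_inter[OF finT] sum_distrib_left sum_distrib_right
    by (intro sum.cong refl) (simp add: kernel c_def power_add)
  also have "\<dots> = (\<Sum>b\<in>B. \<Sum>S\<in>Pow T. \<Sum>b'\<in>B. \<Sum>S'\<in>Pow T. if ok S b \<and> ok S' b' then c (S, b) * G S b S' b' * c (S', b') else 0)"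
    by (intro sum.cong refl sum.swap)
  also have "\<dots> = (\<Sum>S\<in>Pow T. \<Sum>b\<in>B. \<Sum>S'\<in>Pow T. \<Sum>b'\<in>B. if ok S b \<and> ok S' b' then c (S, b) * G S b S' b' * c (S', b') else 0)"
    by (subst sum.swap) (intro sum.cong refl sum.swap)
  also have "\<dots> = (\<Sum>j\<in>Pow T \<times> B. \<Sum>k\<in>Pow T \<times> B.
      if j \<in> J then if k \<in> J then c j * G (fst j) (snd j) (fst k) (snd k) * c k else 0 else 0)"
    unfolding sum.cartesian_product' by (intro sum.cong refl) (auto simp: J_def)
  also have "\<dots> = (\<Sum>j\<in>J. \<Sum>k\<in>J. c j * G (fst j) (snd j) (fst k) (snd k) * c k)"
  proof -
    have "J \<subseteq> Pow T \<times> B" "finite (Pow T \<times> B)" using finT B by (auto simp: J_def)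
    then show ?thesis
      by (intro sum.mono_neutral_cong_right) (auto intro!: sum.mono_neutral_cong_right)
  qed
  also have "\<dots> \<ge> 0"
    unfolding G_def
  proof (rule moment_form_nonneg[OF psd J finT True,
        where a = "\<lambda>j. a (fst j) (e (snd j))" and m = "\<lambda>j. parts_on (N - fst j) (e (snd j))"])
    fix j assume j: "j \<in> J"
    then have S: "fst j \<subseteq> T" by (auto simp: J_def)
    show "a (fst j) (e (snd j)) i = 0" if "i \<notin> T" for i using S that by (auto simp: a_def)
    show "even_partition (parts_on (N - fst j) (e (snd j)))"
      using j by (intro even_partition_parts_on) (auto simp: J_def ok_def)
    have "(\<Sum>i\<in>T. a (fst j) (e (snd j)) i) = (\<Sum>i\<in>fst j. e (snd j) i)"
      using S finT by (intro sum.mono_neutral_cong_right) (auto simp: a_def)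
    moreover have "(\<Sum>i\<in>N. e (snd j) i) = (\<Sum>i\<in>N - fst j. e (snd j) i) + (\<Sum>i\<in>fst j. e (snd j) i)"
      using S N by (intro sum.subset_diff) auto
    moreover have "(\<Sum>i\<in>N. e (snd j) i) = d" using j deg by (auto simp: J_def)
    ultimately show "(\<Sum>i\<in>T. a (fst j) (e (snd j)) i) + \<Sum>\<^sub># (parts_on (N - fst j) (e (snd j))) = d"
      by (simp add: sum_parts_on)
  qed
  finally show ?thesis .
qed

text \<open>For \<open>U = N\<close> nothing is integrated out, so the form is the sum of the forms
  of the Hoeffding components.\<close>

lemma cond_kernel_form_nonneg:
  fixes e :: "'b \<Rightarrow> nat \<Rightarrow> nat"
  assumes "pos_semidef_on (row_indices d) (moment_matrix z)"
    and N: "finite N" and "finite B"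
    and "\<And>b. b \<in> B \<Longrightarrow> (\<Sum>i\<in>N. e b i) = d"
  shows "0 \<le> (\<Sum>b\<in>B. \<Sum>b'\<in>B. q b * cond_kernel z N N (e b) (e b') * q b')"
proof -
  have "(\<Sum>b\<in>B. \<Sum>b'\<in>B. q b * cond_kernel z N N (e b) (e b') * q b') =
    (\<Sum>b\<in>B. \<Sum>b'\<in>B. q b * (\<Sum>T\<in>Pow N. alt_sum T (\<lambda>U. cond_kernel z N U (e b) (e b'))) * q b')"
    by (simp add: sum_alt_sum[OF N])
  also have "\<dots> = (\<Sum>b\<in>B. \<Sum>T\<in>Pow N. \<Sum>b'\<in>B. q b * alt_sum T (\<lambda>U. cond_kernel z N U (e b) (e b')) * q b')"
    unfolding sum_distrib_left sum_distrib_right by (intro sum.cong refl sum.swap)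
  also have "\<dots> = (\<Sum>T\<in>Pow N. \<Sum>b\<in>B. \<Sum>b'\<in>B. q b * alt_sum T (\<lambda>U. cond_kernel z N U (e b) (e b')) * q b')"
    by (rule sum.swap)
  also have "\<dots> \<ge> 0"
    using assms by (intro sum_nonneg alt_sum_cond_kernel_nonneg) auto
  finally show ?thesis .
qed

section \<open>The moment functional on sums of squares\<close>

text \<open>The functional \<open>L_n\<close> on monomials. Cutting off other degrees ensures that
  \<open>z\<close> is evaluated only at even partitions of \<open>2 * d\<close>.\<close>

definition monomial_moment :: "nat \<Rightarrow> (nat multiset \<Rightarrow> real) \<Rightarrow> nat \<Rightarrow> (nat \<Rightarrow>\<^sub>0 nat) \<Rightarrow> real" where
  "monomial_moment d z n m =
    (if var_degree n m = 2 * d \<and> (\<forall>i<n. even (lookup m i)) then z (parts_on {..<n} (lookup m)) else 0)"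

text \<open>By \<open>sum_squares_min_degree\<close>, homogeneity of \<open>p\<close> excludes terms
  of degree below \<open>d\<close> from each \<open>q\<close>. Two terms then multiply to degree
  \<open>2 * d\<close> only if both have degree \<open>d\<close>, so just the degree
  \<open>d\<close> part of \<open>q\<close> counts.\<close>

lemma lin_ext_sos_nonneg:
  assumes psd: "pos_semidef_on (row_indices d) (moment_matrix z)"
    and hom: "\<And>k. lookup p k \<noteq> 0 \<Longrightarrow> var_degree n k = 2 * d"
    and sos: "is_sos n p"
  shows "0 \<le> lin_ext (monomial_moment d z n) p"
proof -
  obtain qs where p: "p = (\<Sum>q\<leftarrow>qs. q ^ 2)" using sos by (auto simp: is_sos_def)
  have "0 \<le> lin_ext (monomial_moment d z n) (q ^ 2)" if "q \<in> set qs" for q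
  proof -
    have low: "d \<le> var_degree n m" if "m \<in> keys q" for m
      using sum_squares_min_degree[of "var_degree n" qs d q m] hom that \<open>q \<in> set qs\<close>
      unfolding p by (simp add: var_degree_add)
    define B where "B = {m \<in> keys q. var_degree n m = d}"
    have "lin_ext (monomial_moment d z n) (q ^ 2) =
      (\<Sum>a\<in>keys q. \<Sum>b\<in>keys q. if a \<in> B then if b \<in> B then
         lookup q a * cond_kernel z {..<n} {..<n} (lookup a) (lookup b) * lookup q b else 0 else 0)"
      unfolding power2_eq_square lin_ext_mult
    proof (intro sum.cong refl)
      fix a b assume "a \<in> keys q" "b \<in> keys q"
      with low[of a] low[of b] have "var_degree n (a + b) = 2 * d \<longleftrightarrow> a \<in> B \<and> b \<in> B"
        by (auto simp: var_degree_add B_def)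
      moreover have "lookup (a + b) = (\<lambda>i. lookup a i + lookup b i)"
        by (simp add: fun_eq_iff lookup_add)
      ultimately show "lookup q a * lookup q b * monomial_moment d z n (a + b) =
        (if a \<in> B then if b \<in> B then
         lookup q a * cond_kernel z {..<n} {..<n} (lookup a) (lookup b) * lookup q b else 0 else 0)"
        by (auto simp: monomial_moment_def cond_kernel_def)
    qed
    also have "\<dots> = (\<Sum>a\<in>B. \<Sum>b\<in>B.
        lookup q a * cond_kernel z {..<n} {..<n} (lookup a) (lookup b) * lookup q b)"
      by (intro sum.mono_neutral_cong_right)
         (auto simp: B_def intro!: sum.mono_neutral_cong_right)
    also have "\<dots> \<ge> 0"
      by (intro cond_kernel_form_nonneg[OF psd]) (auto simp: B_def var_degree_def)
    finally show ?thesis .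
  qed
  then show ?thesis
    unfolding p lin_ext_sum_list by (auto intro!: sum_list_nonneg)
qed

section \<open>Convergence of the functional on products of power means\<close>

text \<open>Multiplying \<open>x^\<gamma>\<close> by \<open>x_i^r\<close> adds \<open>r\<close> as a new part unless \<open>x_i\<close> occurs in \<open>x^\<gamma>\<close>; the
  fraction of such collisions is the source of the error term.\<close>

lemma lin_ext_power_mean_part_approx:
  assumes C: "\<And>\<nu>. \<nu> \<in> even_partitions (2 * d) \<Longrightarrow> \<bar>z \<nu>\<bar> \<le> C" and "0 \<le> C"
    and n: "0 < n"
    and \<mu>: "even_partition \<mu>" and \<gamma>: "\<And>i. i < n \<Longrightarrow> even (lookup \<gamma> i)"
    and deg: "var_degree n \<gamma> + \<Sum>\<^sub># \<mu> = 2 * d"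
  shows "\<bar>lin_ext (\<lambda>b. monomial_moment d z n (\<gamma> + b)) (power_mean_part n \<mu>) -
      z (parts_on {..<n} (lookup \<gamma>) + \<mu>)\<bar>
    \<le> 2 * C * real (size \<mu>) * real (card {i. i < n \<and> lookup \<gamma> i \<noteq> 0} + size \<mu>) / real n"
  using \<mu> \<gamma> deg
proof (induction \<mu> arbitrary: \<gamma>)
  case empty
  then show ?case by (simp add: lin_ext_power_mean_part_empty monomial_moment_def)
next
  case (add r \<mu>)
  have part: "\<bar>z (parts_on {..<n} (lookup \<delta>) + \<nu>)\<bar> \<le> C"
    if "\<And>i. i < n \<Longrightarrow> even (lookup \<delta> i)" "even_partition \<nu>" "var_degree n \<delta> + \<Sum>\<^sub># \<nu> = 2 * d" for \<delta> \<nu>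
    using that by (intro C)
      (auto simp: even_partitions_def even_partition_add sum_parts_on var_degree_def
        intro!: even_partition_parts_on)
  have bound: "\<bar>monomial_moment d z n m\<bar> \<le> C" for m
    using part[of m "{#}"] \<open>0 \<le> C\<close>
    by (auto simp: monomial_moment_def even_partition_def)
  have r: "0 < r" "even r" and \<mu>: "even_partition \<mu>"
    using add.prems(1) by (auto simp: even_partition_def)
  define A where "A = {i. i < n \<and> lookup \<gamma> i \<noteq> 0}"
  define s where "s = card A"
  have A: "finite A" "A \<subseteq> {..<n}" by (auto simp: A_def)
  define L where "L i = lin_ext (\<lambda>b. monomial_moment d z n (\<gamma> + single i r + b)) (power_mean_part n \<mu>)" for i
  define Z where "Z = z (parts_on {..<n} (lookup \<gamma>) + add_mset r \<mu>)"
  have Z: "\<bar>Z\<bar> \<le> C" unfolding Z_def using add.prems by (intro part) auto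
  \<comment> \<open>If \<open>x_i\<close> already occurs in the monomial, only the trivial bound is
    available; there are \<open>s\<close> such \<open>i\<close>.\<close>
  have 1: "\<bar>L i - Z\<bar> \<le> 2 * C" if "i \<in> A" for i
    using lin_ext_power_mean_part_bound[of "\<lambda>b. monomial_moment d z n (\<gamma> + single i r + b)" C n \<mu>, OF bound] Z
    unfolding L_def by linarith
  \<comment> \<open>For a new variable \<open>r\<close> becomes a separate part and the target stays
    \<open>Z\<close>; the induction hypothesis applies with \<open>s + 1\<close> occurring
    variables.\<close>
  have 2: "\<bar>L i - Z\<bar> \<le> 2 * C * size \<mu> * (s + 1 + size \<mu>) / n" if "i < n" "i \<notin> A" for i
  proof -
    have i0: "lookup \<gamma> i = 0" using that by (simp add: A_def)
    have split: "{..<n} = insert i ({..<n} - {i})" using that by auto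
    have rest: "parts_on ({..<n} - {i}) (lookup (\<gamma> + single i r)) = parts_on ({..<n} - {i}) (lookup \<gamma>)"
      by (intro parts_on_cong) (auto simp: lookup_add lookup_single when_def)
    have "parts_on {..<n} (lookup (\<gamma> + single i r)) + \<mu> = parts_on {..<n} (lookup \<gamma>) + add_mset r \<mu>"
      by (subst (1 2) split, subst (1 2) parts_on_insert, unfold rest)
         (use i0 r in \<open>auto simp: lookup_add\<close>)
    moreover have "{j. j < n \<and> lookup (\<gamma> + single i r) j \<noteq> 0} = insert i A"
      using that r by (auto simp: A_def lookup_add lookup_single when_def)
    moreover have "\<bar>L i - z (parts_on {..<n} (lookup (\<gamma> + single i r)) + \<mu>)\<bar> \<le> 2 * C * size \<mu> *
        (card {j. j < n \<and> lookup (\<gamma> + single i r) j \<noteq> 0} + size \<mu>) / n"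
      unfolding L_def using add.prems r \<mu> that
      by (intro add.IH) (auto simp: lookup_add lookup_single when_def var_degree_add var_degree_single)
    ultimately show ?thesis using that A by (simp add: Z_def s_def)
  qed
  have "lin_ext (\<lambda>b. monomial_moment d z n (\<gamma> + b)) (power_mean_part n (add_mset r \<mu>)) - Z =
      (\<Sum>i<n. L i - Z) / n"
    using n by (simp add: lin_ext_power_mean_part_add L_def sum_subtractf add.assoc field_simps)
  also have "\<bar>\<dots>\<bar> \<le> (\<Sum>i<n. \<bar>L i - Z\<bar>) / n"
    by (simp add: divide_right_mono)
  also have "(\<Sum>i<n. \<bar>L i - Z\<bar>) = (\<Sum>i\<in>{..<n} - A. \<bar>L i - Z\<bar>) + (\<Sum>i\<in>A. \<bar>L i - Z\<bar>)"
    using A by (intro sum.subset_diff) auto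
  also have "\<dots> \<le> (\<Sum>i\<in>{..<n} - A. 2 * C * size \<mu> * (s + 1 + size \<mu>) / n) + (\<Sum>i\<in>A. 2 * C)"
    by (intro add_mono sum_mono 1 2) auto
  also have "\<dots> \<le> (\<Sum>i<n. 2 * C * size \<mu> * (s + 1 + size \<mu>) / n) + (\<Sum>i\<in>A. 2 * C)"
    using \<open>0 \<le> C\<close> A by (intro add_mono sum_mono2) auto
  also have "\<dots> = 2 * C * size \<mu> * (s + 1 + size \<mu>) + 2 * C * s"
    using n by (simp add: s_def)
  also have "\<dots> \<le> 2 * C * size (add_mset r \<mu>) * (s + size (add_mset r \<mu>))"
    using \<open>0 \<le> C\<close> by (simp add: algebra_simps)
  finally show ?case
    using n by (simp add: Z_def A_def s_def divide_right_mono)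
qed

text \<open>Starting from the monomial 1, the collision error is at most a constant over
  \<open>n\<close>.\<close>

lemma lin_ext_power_mean_part_tendsto:
  assumes "\<mu> \<in> even_partitions (2 * d)"
  shows "(\<lambda>n. lin_ext (monomial_moment d z n) (power_mean_part n \<mu>)) \<longlonglongrightarrow> z \<mu>"
proof (rule LIM_zero_cancel, rule tendsto_rabs_zero_cancel, rule tendsto_sandwich[OF _ _ tendsto_const])
  define C where "C = (\<Sum>\<nu>\<in>even_partitions (2 * d). \<bar>z \<nu>\<bar>)"
  have C: "\<bar>z \<nu>\<bar> \<le> C" if "\<nu> \<in> even_partitions (2 * d)" for \<nu>
    unfolding C_def using that by (intro member_le_sum finite_even_partitions) auto
  have "0 \<le> C" unfolding C_def by (intro sum_nonneg) auto
  show "(\<lambda>n. 2 * C * real (size \<mu>) * real (size \<mu>) / real n) \<longlonglongrightarrow> 0"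
    by (rule lim_const_over_n)
  show "\<forall>\<^sub>F n in sequentially. \<bar>lin_ext (monomial_moment d z n) (power_mean_part n \<mu>) - z \<mu>\<bar>
      \<le> 2 * C * real (size \<mu>) * real (size \<mu>) / real n"
    using eventually_gt_at_top[of 0]
  proof eventually_elim
    case (elim n)
    then show ?case
      using lin_ext_power_mean_part_approx[where z = z and \<mu> = \<mu> and \<gamma> = 0, OF C \<open>0 \<le> C\<close> elim] assms
      by (simp add: even_partitions_def var_degree_def parts_on_zero)
  qed
qed auto

lemma psd_imp_dual:
  assumes z: "z \<in> coord_space d" "pos_semidef_on (row_indices d) (moment_matrix z)"
  shows "z \<in> even_sym_sos_dual d"
proof -
  have "0 \<le> (\<Sum>\<mu>\<in>even_partitions (2 * d). z \<mu> * c \<mu>)" if c: "c \<in> even_sym_sos d" for c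
  proof (rule LIMSEQ_le_const)
    define p where "p n = (\<Sum>\<mu>\<in>even_partitions (2 * d). poly_const (c \<mu>) * power_mean_part n \<mu>)" for n
    have lin: "lin_ext w (p n) = (\<Sum>\<mu>\<in>even_partitions (2 * d). lin_ext w (power_mean_part n \<mu>) * c \<mu>)" for w n
      by (simp add: p_def lin_ext_sum poly_const_def lin_ext_single_mult mult.commute[of "c _"])
    show "(\<lambda>n. lin_ext (monomial_moment d z n) (p n)) \<longlonglongrightarrow> (\<Sum>\<mu>\<in>even_partitions (2 * d). z \<mu> * c \<mu>)"
      unfolding lin by (intro tendsto_intros lin_ext_power_mean_part_tendsto)
    have "0 \<le> lin_ext (monomial_moment d z n) (p n)" if "2 * d \<le> n" for n
    proof (rule lin_ext_sos_nonneg[OF z(2)])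
      show "is_sos n (p n)" using c that by (simp add: even_sym_sos_def p_def)
      fix k assume k: "lookup (p n) k \<noteq> 0"
      show "var_degree n k = 2 * d"
      proof (rule ccontr)
        \<comment> \<open>The coefficient at \<open>k\<close> is the value of an indicator weight,
          which vanishes on every product of power means in \<open>p n\<close> if \<open>k\<close>
          has the wrong degree.\<close>
        assume "var_degree n k \<noteq> 2 * d"
        then have "lin_ext (\<lambda>m. if m = k then 1 else 0) (power_mean_part n \<mu>) = 0"
          if "\<mu> \<in> even_partitions (2 * d)" for \<mu>
          using that by (intro lin_ext_power_mean_part_homogeneous) (auto simp: even_partitions_def)
        then show False using k by (simp add: lookup_eq_lin_ext lin)
      qed
    qed
    then show "\<exists>N. \<forall>n\<ge>N. 0 \<le> lin_ext (monomial_moment d z n) (p n)" by blast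
  qed
  then show ?thesis using z(1) by (simp add: even_sym_sos_dual_def)
qed


subsection \<open>Averaging over signed substitutions\<close>

lemma polys_in_0 [simp]: "0 \<in> polys_in n"
  by (simp add: polys_in_def)

lemma polys_in_single:
  assumes "keys m \<subseteq> {..<n}"
  shows "single m a \<in> polys_in n"
  using assms by (simp add: polys_in_def)

lemma polys_in_1 [simp]: "1 \<in> polys_in n"
  using polys_in_single[of 0 n 1] by simp

lemma polys_in_add: "p \<in> polys_in n \<Longrightarrow> q \<in> polys_in n \<Longrightarrow> p + q \<in> polys_in n"
  using keys_add[of p q] by (fastforce simp: polys_in_def)

lemma polys_in_mult:
  assumes "p \<in> polys_in n" "q \<in> polys_in n"
  shows "p * q \<in> polys_in n"
  unfolding polys_in_def
proof (intro CollectI ballI)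
  fix m assume "m \<in> keys (p * q)"
  then obtain a b where "m = a + b" "a \<in> keys p" "b \<in> keys q" using keys_mult[of p q] by blast
  then show "keys m \<subseteq> {..<n}" using assms keys_add[of a b] by (fastforce simp: polys_in_def)
qed

lemma polys_in_power: "p \<in> polys_in n \<Longrightarrow> p ^ k \<in> polys_in n"
  by (induction k) (auto intro: polys_in_mult)

lemma polys_in_sum: "(\<And>a. a \<in> A \<Longrightarrow> f a \<in> polys_in n) \<Longrightarrow> sum f A \<in> polys_in n"
  by (induction A rule: infinite_finite_induct) (auto intro: polys_in_add)

lemma polys_in_prod: "(\<And>a. a \<in> A \<Longrightarrow> f a \<in> polys_in n) \<Longrightarrow> prod f A \<in> polys_in n"
  by (induction A rule: infinite_finite_induct) (auto intro: polys_in_mult)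

lemma polys_in_prod_mset: "(\<And>a. a \<in># A \<Longrightarrow> f a \<in> polys_in n) \<Longrightarrow> (\<Prod>a\<in>#A. f a) \<in> polys_in n"
  by (induction A) (auto intro: polys_in_mult)

lemma polys_in_const: "poly_const a \<in> polys_in n"
  unfolding poly_const_def by (rule polys_in_single) simp

lemma polys_in_var: "i < n \<Longrightarrow> poly_var i \<in> polys_in n"
  unfolding poly_var_def by (rule polys_in_single) simp

lemma polys_in_power_mean_part: "power_mean_part n \<mu> \<in> polys_in n"
  unfolding power_mean_part_def power_mean_def
  by (intro polys_in_prod_mset polys_in_mult polys_in_const polys_in_sum polys_in_power polys_in_var) simp

lemma poly_const_mult: "poly_const (a * b) = poly_const a * poly_const b"
  by (simp add: poly_const_def mult_single)

lemma poly_const_1 [simp]: "poly_const 1 = 1"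
  by (simp add: poly_const_def)

lemma poly_const_0 [simp]: "poly_const 0 = 0"
  by (simp add: poly_const_def)

lemma poly_const_add: "poly_const (a + b) = poly_const a + poly_const b"
  by (simp add: poly_const_def single_add)

lemma poly_const_power: "poly_const (a ^ k) = poly_const a ^ k"
  by (induction k) (auto simp: poly_const_mult)

lemma is_sos_sum_squares:
  assumes "finite A" "\<And>a. a \<in> A \<Longrightarrow> f a \<in> polys_in n"
  shows "is_sos n (\<Sum>a\<in>A. f a ^ 2)"
proof -
  obtain xs where "set xs = A" "distinct xs" using finite_distinct_list[OF assms(1)] by blast
  then show ?thesis
    using assms(2) by (auto simp: is_sos_def sum_list_distinct_conv_sum_set comp_def
        intro!: exI[of _ "map f xs"])
qed

definition signed_vars :: "nat \<Rightarrow> (nat \<times> real) set" where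
  "signed_vars n = {..<n} \<times> {1, -1}"

definition signed_var :: "nat \<times> real \<Rightarrow> mpoly" where
  "signed_var s = poly_const (snd s) * poly_var (fst s)"

text \<open>Opposite signs cancel odd powers and double even ones. For \<open>r = 0\<close> the
  average is 1, written with the empty partition because parts are positive.\<close>

lemma signed_var_average:
  assumes "0 < n"
  shows "poly_const (1 / (2 * real n)) * (\<Sum>s\<in>signed_vars n. signed_var s ^ r) =
    (if even r then power_mean_part n (if r = 0 then {#} else {#r#}) else 0)"
proof -
  have "(\<Sum>s\<in>signed_vars n. signed_var s ^ r) = (\<Sum>i<n. poly_const (1 + (-1) ^ r) * poly_var i ^ r)"
    unfolding signed_vars_def signed_var_def sum.cartesian_product'
    by (intro sum.cong refl) (simp add: power_mult_distrib poly_const_add algebra_simps flip: poly_const_power)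
  also have "\<dots> = poly_const (1 + (-1) ^ r) * (\<Sum>i<n. poly_var i ^ r)"
    by (simp add: sum_distrib_left)
  finally have eq: "poly_const (1 / (2 * real n)) * (\<Sum>s\<in>signed_vars n. signed_var s ^ r) =
    poly_const (1 / (2 * real n) * (1 + (-1) ^ r)) * (\<Sum>i<n. poly_var i ^ r)"
    by (simp only: poly_const_mult mult.assoc)
  have "poly_const (1 / real n) * (\<Sum>i<n. poly_var i ^ 0) = 1"
    using assms by (simp add: poly_const_def mult_single flip: single_of_nat)
  with eq show ?thesis
    by (auto simp: power_mean_part_def power_mean_def)
qed

lemma power_mean_part_add: "power_mean_part n (\<mu> + \<nu>) = power_mean_part n \<mu> * power_mean_part n \<nu>"
  by (simp add: power_mean_part_def)

lemma power_mean_part_parts_on: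
  assumes "finite V"
  shows "power_mean_part n (parts_on V g) = (\<Prod>i\<in>V. power_mean_part n (if g i = 0 then {#} else {#g i#}))"
  using assms
  by (induction V rule: finite_induct)
     (simp_all add: parts_on_insert power_mean_part_add, simp_all add: power_mean_part_def)

text \<open>The \<open>d\<close> slots are filled independently, repetitions allowed, so the average
  of the product is the product of the averages.\<close>

lemma signed_var_average_prod:
  assumes "0 < n"
  shows "poly_const ((1 / (2 * real n)) ^ d) *
      (\<Sum>\<sigma>\<in>{..<d} \<rightarrow>\<^sub>E signed_vars n. \<Prod>j<d. signed_var (\<sigma> j) ^ g j) =
    (if \<forall>j<d. even (g j) then power_mean_part n (parts_on {..<d} g) else 0)"
proof -
  have "finite (signed_vars n)" by (simp add: signed_vars_def)
  then have "(\<Sum>\<sigma>\<in>{..<d} \<rightarrow>\<^sub>E signed_vars n. \<Prod>j<d. signed_var (\<sigma> j) ^ g j) =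
      (\<Prod>j<d. \<Sum>s\<in>signed_vars n. signed_var s ^ g j)"
    by (subst prod_sum_PiE) auto
  then have "poly_const ((1 / (2 * real n)) ^ d) *
      (\<Sum>\<sigma>\<in>{..<d} \<rightarrow>\<^sub>E signed_vars n. \<Prod>j<d. signed_var (\<sigma> j) ^ g j) =
      (\<Prod>j<d. poly_const (1 / (2 * real n)) * (\<Sum>s\<in>signed_vars n. signed_var s ^ g j))"
    by (simp add: prod.distrib poly_const_power)
  also have "\<dots> = (\<Prod>j<d. if even (g j) then power_mean_part n (if g j = 0 then {#} else {#g j#}) else 0)"
    by (simp only: signed_var_average[OF assms])
  also have "\<dots> = (if \<forall>j<d. even (g j) then power_mean_part n (parts_on {..<d} g) else 0)"
  proof (cases "\<forall>j<d. even (g j)")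
    case True
    then show ?thesis by (simp add: power_mean_part_parts_on)
  next
    case False
    then obtain j where "j < d" "odd (g j)" by blast
    then have "(\<Prod>j<d. if even (g j) then power_mean_part n (if g j = 0 then {#} else {#g j#}) else 0) = 0"
      by (intro prod_zero bexI[of _ j]) auto
    with False show ?thesis by (simp only: if_False)
  qed
  finally show ?thesis .
qed

lemma moment_matrix_nth:
  assumes "r \<in> row_indices d" "s \<in> row_indices d"
  shows "moment_matrix z r s = (if \<forall>j<d. even (fst r ! j + fst s ! j)
    then z (parts_on {..<d} (\<lambda>j. fst r ! j + fst s ! j) + snd r + snd s) else 0)"
proof -
  have "vec_add (fst r) (fst s) = map (\<lambda>j. fst r ! j + fst s ! j) [0..<d]"
    using assms by (intro nth_equalityI) (auto simp: vec_add_def row_indices_def)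
  then have "(\<forall>k\<in>set (vec_add (fst r) (fst s)). even k) \<longleftrightarrow> (\<forall>j<d. even (fst r ! j + fst s ! j))"
    "parts_of (vec_add (fst r) (fst s)) = parts_on {..<d} (\<lambda>j. fst r ! j + fst s ! j)"
    by (auto simp: parts_of_map atLeast0LessThan)
  then show ?thesis
    by (simp only: moment_matrix_def case_prod_beta)
qed

text \<open>The moment form at \<open>v\<close> with products of power means in place of the
  coordinates of \<open>z\<close>. It is the average of the squares of the polynomials obtained by
  signed substitution.\<close>

lemma is_sos_moment_form:
  assumes "0 < n"
  shows "is_sos n (\<Sum>r\<in>row_indices d. \<Sum>s\<in>row_indices d. poly_const (v r * v s) *
    (if \<forall>j<d. even (fst r ! j + fst s ! j)
     then power_mean_part n (parts_on {..<d} (\<lambda>j. fst r ! j + fst s ! j) + snd r + snd s) else 0))"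
    (is "is_sos n ?p")
proof -
  define I where "I = row_indices d"
  define P where "P = {..<d} \<rightarrow>\<^sub>E signed_vars n"
  have "finite P" unfolding P_def by (intro finite_PiE) (auto simp: signed_vars_def)
  define k where "k = (1 / (2 * real n)) ^ d"
  define mon where "mon \<sigma> r = (\<Prod>j<d. signed_var (\<sigma> j) ^ (fst r ! j))" for \<sigma> and r :: "nat list \<times> nat multiset"
  \<comment> \<open>The factor \<open>sqrt k\<close> absorbs the averaging weight \<open>k\<close>
    into the square.\<close>
  define f where "f \<sigma> = poly_const (sqrt k) *
    (\<Sum>r\<in>I. poly_const (v r) * mon \<sigma> r * power_mean_part n (snd r))" for \<sigma>
  have "k \<ge> 0" by (simp add: k_def)
  define ev where "ev r s \<longleftrightarrow> (\<forall>j<d. even (fst r ! j + fst s ! j))"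
    for r s :: "nat list \<times> nat multiset"
  have mon: "poly_const k * (\<Sum>\<sigma>\<in>P. mon \<sigma> r * mon \<sigma> s) = (if ev r s
     then power_mean_part n (parts_on {..<d} (\<lambda>j. fst r ! j + fst s ! j)) else 0)" for r s
    using signed_var_average_prod[OF assms, of d "\<lambda>j. fst r ! j + fst s ! j"]
    by (simp add: mon_def k_def P_def ev_def power_add prod.distrib)
  have sq: "f \<sigma> ^ 2 = (\<Sum>r\<in>I. \<Sum>s\<in>I. poly_const k * (mon \<sigma> r * mon \<sigma> s) *
     (poly_const (v r * v s) * power_mean_part n (snd r + snd s)))" for \<sigma>
    using \<open>k \<ge> 0\<close>
    unfolding f_def power_mult_distrib poly_const_power[symmetric] power2_eq_square[of "sum _ _"]
    by (simp add: sum_product sum_distrib_left poly_const_mult power_mean_part_add mult_ac)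
  have "?p = (\<Sum>r\<in>I. \<Sum>s\<in>I. (poly_const k * (\<Sum>\<sigma>\<in>P. mon \<sigma> r * mon \<sigma> s)) *
     (poly_const (v r * v s) * power_mean_part n (snd r + snd s)))"
    unfolding mon I_def ev_def[symmetric]
    by (intro sum.cong refl) (simp add: power_mean_part_add mult_ac)
  also have "\<dots> = (\<Sum>r\<in>I. \<Sum>s\<in>I. \<Sum>\<sigma>\<in>P. poly_const k * (mon \<sigma> r * mon \<sigma> s) *
     (poly_const (v r * v s) * power_mean_part n (snd r + snd s)))"
    by (simp only: sum_distrib_left sum_distrib_right)
  also have "\<dots> = (\<Sum>r\<in>I. \<Sum>\<sigma>\<in>P. \<Sum>s\<in>I. poly_const k * (mon \<sigma> r * mon \<sigma> s) *
     (poly_const (v r * v s) * power_mean_part n (snd r + snd s)))"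
    by (intro sum.cong refl sum.swap)
  also have "\<dots> = (\<Sum>\<sigma>\<in>P. f \<sigma> ^ 2)"
    unfolding sq by (rule sum.swap)
  finally have eq: "?p = (\<Sum>\<sigma>\<in>P. f \<sigma> ^ 2)" .
  have "f \<sigma> \<in> polys_in n" if "\<sigma> \<in> P" for \<sigma>
  proof -
    have "signed_var (\<sigma> j) \<in> polys_in n" if "j < d" for j
    proof -
      have "\<sigma> j \<in> signed_vars n" using \<open>\<sigma> \<in> P\<close> that by (auto simp: P_def)
      then show ?thesis unfolding signed_var_def
        by (intro polys_in_mult polys_in_const polys_in_var) (auto simp: signed_vars_def)
    qed
    then show ?thesis
      unfolding f_def mon_def
      by (intro polys_in_mult polys_in_const polys_in_sum polys_in_prod polys_in_power
          polys_in_power_mean_part) auto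
  qed
  then show ?thesis unfolding eq by (rule is_sos_sum_squares[OF \<open>finite P\<close>])
qed

lemma dual_imp_psd:
  assumes "d \<ge> 1" and z: "z \<in> even_sym_sos_dual d"
  shows "pos_semidef_on (row_indices d) (moment_matrix z)"
  unfolding pos_semidef_on_def
proof (intro conjI ballI allI)
  fix v :: "nat list \<times> nat multiset \<Rightarrow> real"
  define I where "I = row_indices d"
  define E where "E = even_partitions (2 * d)"
  have fin: "finite I" "finite E" by (simp_all add: I_def E_def finite_row_indices finite_even_partitions)
  define ev where "ev r s \<longleftrightarrow> (\<forall>j<d. even (fst r ! j + fst s ! j))"
    for r s :: "nat list \<times> nat multiset"
  define pt where "pt r s = parts_on {..<d} (\<lambda>j. fst r ! j + fst s ! j) + snd r + snd s"
    for r s :: "nat list \<times> nat multiset"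
  \<comment> \<open>Index pairs with the same partition are merged, which gives the coordinates of
    the sum of squares from \<open>is_sos_moment_form\<close>; \<open>restrict\<close> makes
    \<open>c\<close> extensional.\<close>
  define c where "c = restrict (\<lambda>\<mu>. \<Sum>r\<in>I. \<Sum>s\<in>I. if ev r s \<and> pt r s = \<mu> then v r * v s else 0) E"
  have pt: "pt r s \<in> E" if "r \<in> I" "s \<in> I" "ev r s" for r s
  proof -
    have "(\<Sum>j<d. fst r ! j) + \<Sum>\<^sub># (snd r) = d" if "r \<in> I" for r
      using that by (auto simp: I_def row_indices_def sum_list_sum_nth atLeast0LessThan)
    from this[OF that(1)] this[OF that(2)] show ?thesis
      using that unfolding E_def even_partitions_def pt_def
      by (auto simp: I_def row_indices_def even_partition_add sum_parts_on sum.distrib ev_def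
          intro!: even_partition_parts_on)
  qed
  \<comment> \<open>Stated for a general \<open>F\<close> because the regrouping is needed twice:
    for the polynomial with coefficients \<open>c\<close> and for the pairing of \<open>z\<close>
    with \<open>c\<close>.\<close>
  have collect: "(\<Sum>\<mu>\<in>E. F (c \<mu>) \<mu>) = (\<Sum>r\<in>I. \<Sum>s\<in>I. if ev r s then F (v r * v s) (pt r s) else 0)"
    if add: "\<And>a b \<mu>. F (a + b) \<mu> = F a \<mu> + F b \<mu>" and zero: "\<And>\<mu>. F 0 \<mu> = 0"
    for F :: "real \<Rightarrow> nat multiset \<Rightarrow> 'b :: comm_monoid_add"
  proof -
    have Fsum: "F (sum h A) \<mu> = (\<Sum>a\<in>A. F (h a) \<mu>)" for h \<mu> and A :: "(nat list \<times> nat multiset) set"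
      by (induction A rule: infinite_finite_induct) (auto simp: add zero)
    have "(\<Sum>\<mu>\<in>E. F (c \<mu>) \<mu>) = (\<Sum>\<mu>\<in>E. \<Sum>r\<in>I. \<Sum>s\<in>I. if ev r s \<and> pt r s = \<mu> then F (v r * v s) \<mu> else 0)"
      by (intro sum.cong refl) (auto simp: c_def Fsum zero intro!: sum.cong)
    also have "\<dots> = (\<Sum>r\<in>I. \<Sum>s\<in>I. \<Sum>\<mu>\<in>E. if ev r s \<and> pt r s = \<mu> then F (v r * v s) \<mu> else 0)"
      by (subst sum.swap) (intro sum.cong refl sum.swap)
    also have "\<dots> = (\<Sum>r\<in>I. \<Sum>s\<in>I. if ev r s then F (v r * v s) (pt r s) else 0)"
    proof (intro sum.cong refl)
      fix r s assume "r \<in> I" "s \<in> I"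
      then show "(\<Sum>\<mu>\<in>E. if ev r s \<and> pt r s = \<mu> then F (v r * v s) \<mu> else 0) =
        (if ev r s then F (v r * v s) (pt r s) else 0)"
        using pt fin by (cases "ev r s") auto
    qed
    finally show ?thesis .
  qed
  have "is_sos n (\<Sum>\<mu>\<in>E. poly_const (c \<mu>) * power_mean_part n \<mu>)" if "2 * d \<le> n" for n
  proof -
    \<comment> \<open>Here \<open>d \<ge> 1\<close> enters: averaging needs at least one
      variable.\<close>
    have "0 < n" using assms(1) that by simp
    have "(\<Sum>\<mu>\<in>E. poly_const (c \<mu>) * power_mean_part n \<mu>) =
      (\<Sum>r\<in>I. \<Sum>s\<in>I. if ev r s then poly_const (v r * v s) * power_mean_part n (pt r s) else 0)"
      by (rule collect) (simp_all add: poly_const_add distrib_right)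
    also have "\<dots> = (\<Sum>r\<in>I. \<Sum>s\<in>I. poly_const (v r * v s) *
        (if ev r s then power_mean_part n (pt r s) else 0))"
      by (intro sum.cong refl) auto
    finally show ?thesis
      using is_sos_moment_form[OF \<open>0 < n\<close>, where d = d and v = v]
      by (simp only: I_def ev_def pt_def)
  qed
  then have "c \<in> even_sym_sos d"
    by (simp add: even_sym_sos_def coord_space_def E_def[symmetric]) (simp add: c_def)
  then have "0 \<le> (\<Sum>\<mu>\<in>E. z \<mu> * c \<mu>)"
    using z by (simp add: even_sym_sos_dual_def E_def)
  also have "\<dots> = (\<Sum>r\<in>I. \<Sum>s\<in>I. if ev r s then z (pt r s) * (v r * v s) else 0)"
    by (rule collect) (simp_all add: distrib_left)
  also have "\<dots> = (\<Sum>r\<in>I. \<Sum>s\<in>I. v r * moment_matrix z r s * v s)"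
    unfolding I_def
    by (intro sum.cong refl) (simp add: moment_matrix_nth[of _ d, folded ev_def pt_def])
  finally show "0 \<le> (\<Sum>r\<in>row_indices d. \<Sum>s\<in>row_indices d. v r * moment_matrix z r s * v s)"
    by (simp add: I_def)
qed (rule moment_matrix_sym)

theorem theorem3p24:
  fixes d :: nat
  assumes "d \<ge> 1"
  shows "even_sym_sos_dual d =
    {z \<in> coord_space d. pos_semidef_on (row_indices d) (moment_matrix z)}"
  using dual_imp_psd[OF assms] psd_imp_dual by (auto simp: even_sym_sos_dual_def)

end
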